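(* Let $\mathcal{K}\subseteq\mathbb{C}_h^{n\times n}$ be an SDG whose dual quantum credal set is a singleton $\mathcal{M}=\{\hat\rho\}$, and let $\Pi_i$ be a projector of a projection measurement $\{\Pi_1,\dots,\Pi_n\}$. Then the coherent lower and upper previsions of the gamble $\Pi_i$ induced by $\mathcal{K}$ coincide, and their common value is $$P(\Pi_i)=\underline{P}(\Pi_i)=\overline{P}(\Pi_i)=\mathrm{Tr}(\Pi_i\hat\rho\,\Pi_i).$$
   Context: $\mathbb{C}_h^{n\times n}$ is the real vector space of $n\times n$ complex Hermitian matrices, with inner product $G\cdot R=\mathrm{Tr}(G^\dagger R)$. $G\gneq 0$ means $G$ is positive semi-definite and $G\ne 0$; $G>0$ means positive definite. $\mathcal{D}_h^{n\times n}$ is the set of density matrices (positive semi-definite Hermitian, trace one). A set $\mathcal{K}\subseteq\mathbb{C}_h^{n\times n}$ is a coherent set of strictly desirable gambles (SDG) if: (S1) it is closed under addition and under multiplication by reals $\nu>0$, and $0\notin\mathcal{K}$; (S2) every $G\gneq 0$ belongs to $\mathcal{K}$; (S3) if $G\in\mathcal{K}$ then either $G\gneq 0$ or $G-\Delta\in\mathcal{K}$ for some $\Delta>0$. Its dual quantum credal set is $\mathcal{M}=\{\rho\in\mathcal{D}_h^{n\times n}\mid G\cdot\rho\ge 0\ \forall G\in\mathcal{K}\}$. For $G\in\mathbb{C}_h^{n\times n}$ the coherent lower and upper previsions are $\underline{P}(G)=\sup\{c\in\mathbb{R}\mid G-cI\in\mathcal{K}\}$ and $\overline{P}(G)=\inf\{c\in\mathbb{R}\mid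 cI-G\in\mathcal{K}\}$. A projection measurement is a family of Hermitian matrices $\Pi_1,\dots,\Pi_n$ with $\Pi_i^2=\Pi_i=\Pi_i^\dagger$, $\Pi_i\Pi_k=0$ for $i\ne k$, $\sum_i\Pi_i=I$. *)

theory Defs
  imports "HOL-Analysis.Analysis"
begin

type_synonym 'n cmat = "complex ^ 'n ^ 'n"

definition dagger :: "'n::finite cmat \<Rightarrow> 'n cmat" where
  "dagger A = (\<chi> i j. cnj (A $ j $ i))"

definition hermitian_matrices :: "'n::finite cmat set" where
  "hermitian_matrices = {A. dagger A = A}"

text \<open>The inner product Tr(G* R) is real on Hermitian matrices, the only place it is used;
  hence taking the real part merely changes the type.\<close>

definition gdot :: "'n::finite cmat \<Rightarrow> 'n cmat \<Rightarrow> real" where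
  "gdot G R = Re (trace (dagger G ** R))"

definition quad_form :: "'n::finite cmat \<Rightarrow> complex ^ 'n \<Rightarrow> complex" where
  "quad_form A x = (\<Sum>i\<in>UNIV. cnj (x $ i) * (A *v x) $ i)"

text \<open>As with \<^term>\<open>gdot\<close>, the quadratic form of a Hermitian matrix is real-valued.\<close>

definition pos_semidef :: "'n::finite cmat \<Rightarrow> bool" where
  "pos_semidef A \<longleftrightarrow> A \<in> hermitian_matrices \<and> (\<forall>x. Re (quad_form A x) \<ge> 0)"

definition pos_def :: "'n::finite cmat \<Rightarrow> bool" where
  "pos_def A \<longleftrightarrow> A \<in> hermitian_matrices \<and> (\<forall>x. x \<noteq> 0 \<longrightarrow> Re (quad_form A x) > 0)"

definition density_matrices :: "'n::finite cmat set" where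
  "density_matrices = {\<rho>. pos_semidef \<rho> \<and> trace \<rho> = 1}"

definition SDG :: "'n::finite cmat set \<Rightarrow> bool" where
  "SDG K \<longleftrightarrow>
     K \<subseteq> hermitian_matrices \<and>
     (\<forall>G\<in>K. \<forall>R\<in>K. G + R \<in> K) \<and>
     (\<forall>G\<in>K. \<forall>\<nu>::real. \<nu> > 0 \<longrightarrow> \<nu> *\<^sub>R G \<in> K) \<and>
     0 \<notin> K \<and>
     (\<forall>G. pos_semidef G \<and> G \<noteq> 0 \<longrightarrow> G \<in> K) \<and>
     (\<forall>G\<in>K. (pos_semidef G \<and> G \<noteq> 0) \<or> (\<exists>\<Delta>. pos_def \<Delta> \<and> G - \<Delta> \<in> K))"

definition quantum_credal_set :: "'n::finite cmat set \<Rightarrow> 'n cmat set" where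
  "quantum_credal_set K = {\<rho> \<in> density_matrices. \<forall>G\<in>K. gdot G \<rho> \<ge> 0}"

text \<open>For Hermitian \<open>G\<close> and \<open>SDG K\<close> the two sets below are nonempty and bounded on the relevant
  side, so the real-valued \<open>Sup\<close> and \<open>Inf\<close> are genuine suprema and infima.\<close>

definition lower_prevision :: "'n::finite cmat set \<Rightarrow> 'n cmat \<Rightarrow> real" where
  "lower_prevision K G = Sup {c::real. G - c *\<^sub>R mat 1 \<in> K}"

definition upper_prevision :: "'n::finite cmat set \<Rightarrow> 'n cmat \<Rightarrow> real" where
  "upper_prevision K G = Inf {c::real. c *\<^sub>R mat 1 - G \<in> K}"

text \<open>The \<open>n\<close> members of the family are indexed by the index type of the matrices itself. Members
  may be zero.\<close>

definition projection_measurement :: "('n::finite \<Rightarrow> 'n cmat) \<Rightarrow> bool" where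
  "projection_measurement P \<longleftrightarrow>
     (\<forall>i. P i ** P i = P i \<and> dagger (P i) = P i) \<and>
     (\<forall>i k. i \<noteq> k \<longrightarrow> P i ** P k = 0) \<and>
     (\<Sum>i\<in>UNIV. P i) = mat 1"

end

(* If a Hermitian G is not in K, then K and G are separated by a nonzero Hermitian functional that is
   nonnegative on K. It is nonnegative on the positive semidefinite matrices, hence positive
   semidefinite itself, and after normalising the trace it lies in the credal set, so it is \<rho>.
   Thus G \<bullet> \<rho> > 0 implies G \<in> K, while G \<in> K implies G \<bullet> \<rho> \<ge> 0, and both previsions of G
   equal G \<bullet> \<rho>. *)

theory Submission
  imports Defs
begin

section \<open>Conjugate transpose, trace and inner product\<close>

lemma dagger_add: "dagger (A + B) = dagger A + dagger B"
  by (simp add: dagger_def vec_eq_iff)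

lemma dagger_diff: "dagger (A - B) = dagger A - dagger B"
  by (simp add: dagger_def vec_eq_iff)

lemma dagger_scaleR: "dagger (c *\<^sub>R A) = c *\<^sub>R dagger A"
  by (simp add: dagger_def vec_eq_iff)

lemma dagger_dagger: "dagger (dagger A) = A"
  by (simp add: dagger_def vec_eq_iff)

lemma dagger_mat_1: "dagger (mat 1) = mat 1"
  by (simp add: dagger_def mat_def vec_eq_iff)

lemma dagger_mult: "dagger (A ** B) = dagger B ** dagger A"
  by (simp add: dagger_def matrix_matrix_mult_def vec_eq_iff mult.commute)

lemma trace_dagger: "trace (dagger A) = cnj (trace A)"
  by (simp add: dagger_def trace_def)

lemma inner_dagger: "inner (dagger A) B = inner A (dagger B)"
proof -
  have "inner (dagger A) B = (\<Sum>i\<in>UNIV. \<Sum>j\<in>UNIV. inner (cnj (A $ j $ i)) (B $ i $ j))"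
    by (simp add: dagger_def inner_vec_def)
  also have "\<dots> = (\<Sum>i\<in>UNIV. \<Sum>j\<in>UNIV. inner (A $ j $ i) (cnj (B $ i $ j)))"
    by (simp add: inner_complex_def)
  also have "\<dots> = inner A (dagger B)"
    by (subst sum.swap) (simp add: dagger_def inner_vec_def)
  finally show ?thesis .
qed

text \<open>Makes separation by hyperplanes, which is phrased with \<open>inner\<close>, available
  for the trace form.\<close>

lemma gdot_eq_inner: "gdot A B = inner A B"
proof -
  have "gdot A B = (\<Sum>i\<in>UNIV. \<Sum>j\<in>UNIV. inner (A $ j $ i) (B $ j $ i))"
    by (simp add: gdot_def trace_def dagger_def matrix_matrix_mult_def inner_complex_def)
  also have "\<dots> = inner A B"
    by (subst sum.swap) (simp add: inner_vec_def)
  finally show ?thesis .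
qed

lemma inner_mat_1: "inner (mat 1) A = Re (trace A)"
proof -
  have "dagger (mat 1) ** A = A"
    by (simp add: dagger_mat_1)
  then show ?thesis
    using gdot_eq_inner[of "mat 1" A] by (simp add: gdot_def)
qed

section \<open>Quadratic forms and the cone of positive semidefinite matrices\<close>

lemma Re_quad_form_eq_inner: "Re (quad_form A x) = inner x (A *v x)"
  by (simp add: quad_form_def inner_vec_def inner_complex_def)

lemma matrix_vector_mult_scaleR_left:
  fixes A :: "complex ^ 'n::finite ^ 'm::finite"
  shows "(c *\<^sub>R A) *v x = c *\<^sub>R (A *v x)"
  by (simp add: matrix_vector_mult_def vec_eq_iff scaleR_right.sum)

lemma linear_matrix_vector_mult:
  fixes A :: "complex ^ 'n::finite ^ 'm::finite"
  shows "linear (\<lambda>x. A *v x)"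
  by (rule linearI)
    (simp_all add: matrix_vector_mult_def vec_eq_iff scaleR_right.sum sum.distrib algebra_simps)

lemma pos_semidef_scaleR:
  assumes "pos_semidef A" "c \<ge> 0"
  shows "pos_semidef (c *\<^sub>R A)"
  using assms
  by (simp add: pos_semidef_def hermitian_matrices_def dagger_scaleR Re_quad_form_eq_inner
      matrix_vector_mult_scaleR_left)

lemma pos_semidef_mat_1: "pos_semidef (mat 1)"
  by (simp add: pos_semidef_def hermitian_matrices_def dagger_mat_1 Re_quad_form_eq_inner)

text \<open>If \<open>B\<close> bounds the operator norm of \<open>A\<close>, Cauchy-Schwarz bounds
  its quadratic form by \<open>B * inner x x\<close>, so \<open>t = 1 / B\<close> works. No
  eigenvalues are involved.\<close>

lemma ex_pos_semidef_mat_1_minus: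
  fixes A :: "'n::finite cmat"
  assumes "A \<in> hermitian_matrices"
  obtains t where "t > 0" "pos_semidef (mat 1 - t *\<^sub>R A)"
proof -
  obtain B where B: "B > 0" "\<And>x. norm (A *v x) \<le> B * norm x"
    using linear_bounded_pos[OF linear_matrix_vector_mult[of A]] by blast
  have "inner x ((mat 1 - (1 / B) *\<^sub>R A) *v x) \<ge> 0" for x
  proof -
    have "inner x (A *v x) \<le> norm x * norm (A *v x)"
      by (rule norm_cauchy_schwarz)
    also have "\<dots> \<le> norm x * (B * norm x)"
      by (intro mult_left_mono B) simp
    also have "\<dots> = B * inner x x"
      by (simp add: dot_square_norm power2_eq_square)
    finally show ?thesis
      using \<open>B > 0\<close>
      by (simp add: matrix_vector_mult_diff_rdistrib matrix_vector_mult_scaleR_left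
          inner_diff_right field_simps)
  qed
  then have "pos_semidef (mat 1 - (1 / B) *\<^sub>R A)"
    using assms
    by (simp add: pos_semidef_def hermitian_matrices_def dagger_diff dagger_scaleR dagger_mat_1
        Re_quad_form_eq_inner)
  then show thesis
    using that[of "1 / B"] \<open>B > 0\<close> by simp
qed

text \<open>The rank-one matrix x x*, a test matrix: pairing with it evaluates a quadratic form at
  \<open>x\<close>.\<close>

definition outer_square :: "complex ^ 'n::finite \<Rightarrow> 'n cmat" where
  "outer_square x = (\<chi> i j. x $ i * cnj (x $ j))"

lemma pos_semidef_outer_square: "pos_semidef (outer_square x)"
proof -
  have "Re (quad_form (outer_square x) y) \<ge> 0" for y
  proof -
    \<comment> \<open>\<open>s\<close> is the Hermitian product of \<open>x\<close> and
      \<open>y\<close>; the quadratic form at \<open>y\<close> becomes the squared modulus of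
      \<open>s\<close>.\<close>
    define s where "s = (\<Sum>j\<in>UNIV. cnj (x $ j) * y $ j)"
    have "(outer_square x *v y) $ i = x $ i * s" for i
      by (simp add: outer_square_def matrix_vector_mult_def s_def sum_distrib_left mult.assoc)
    then have "quad_form (outer_square x) y = (\<Sum>i\<in>UNIV. cnj (y $ i) * x $ i) * s"
      by (simp add: quad_form_def sum_distrib_right mult.assoc)
    also have "(\<Sum>i\<in>UNIV. cnj (y $ i) * x $ i) = cnj s"
      by (simp add: s_def mult.commute)
    finally show ?thesis
      by simp
  qed
  then show ?thesis
    by (simp add: pos_semidef_def hermitian_matrices_def dagger_def outer_square_def vec_eq_iff
        mult.commute)
qed

lemma inner_outer_square: "inner (outer_square x) A = Re (quad_form A x)"
  by (simp add: outer_square_def inner_vec_def quad_form_def matrix_vector_mult_def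
      inner_complex_def sum_distrib_left algebra_simps)

text \<open>One half of the self-duality of the positive semidefinite cone; rank-one tests
  \<open>outer_square x\<close> suffice.\<close>

lemma pos_semidef_if_inner_nonneg:
  assumes "A \<in> hermitian_matrices"
    and "\<And>B. pos_semidef B \<Longrightarrow> inner B A \<ge> 0"
  shows "pos_semidef A"
  using assms(1) assms(2)[OF pos_semidef_outer_square]
  by (simp add: pos_semidef_def inner_outer_square)

text \<open>Testing \<open>A\<close> against \<open>mat 1 - t *\<^sub>R A\<close> bounds the trace
  from below by \<open>t * inner A A\<close>, which is positive.\<close>

lemma Re_trace_pos:
  assumes "A \<in> hermitian_matrices" "A \<noteq> 0"
    and "\<And>B. pos_semidef B \<Longrightarrow> inner B A \<ge> 0"
  shows "Re (trace A) > 0"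
proof -
  obtain t where t: "t > 0" "pos_semidef (mat 1 - t *\<^sub>R A)"
    using ex_pos_semidef_mat_1_minus[OF assms(1)] .
  have "0 < t * inner A A"
    using t(1) assms(2) by simp
  also have "\<dots> \<le> inner (mat 1) A"
    using assms(3)[OF t(2)] by (simp add: inner_diff_left)
  finally show ?thesis
    by (simp add: inner_mat_1)
qed

lemma hermitian_trace_real:
  assumes "A \<in> hermitian_matrices"
  shows "complex_of_real (Re (trace A)) = trace A"
  using assms trace_dagger[of A] by (simp add: hermitian_matrices_def complex_eq_iff)

section \<open>Linear functions bounded below on lines and rays\<close>

lemma affine_bounded_below_slope_zero:
  fixes b m c :: real
  assumes "\<And>t. b \<le> c + t * m"
  shows "m = 0"
proof (rule ccontr)
  assume "m \<noteq> 0"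
  \<comment> \<open>At this argument the affine function takes the value
    \<open>b - 1\<close>.\<close>
  then show False
    using assms[of "(b - c - 1) / m"] by simp
qed

text \<open>The two ends of the ray give the two claims: large \<open>t\<close> fixes the sign of
  \<open>m\<close>, and \<open>t\<close> tending to 0 that of \<open>b\<close>. This removes the
  offset of a hyperplane bounding a cone.\<close>

lemma ray_bounded_below:
  fixes b m :: real
  assumes "\<And>t. t > 0 \<Longrightarrow> b \<le> t * m"
  shows "m \<ge> 0" "b \<le> 0"
proof -
  show "m \<ge> 0"
  proof (rule ccontr)
    \<comment> \<open>The argument chosen below is positive and gives
      \<open>t * m = - (\<bar>b\<bar> + 1)\<close>, which is less than \<open>b\<close>.\<close>
    assume "\<not> m \<ge> 0"
    then show False
      using assms[of "(\<bar>b\<bar> + 1) / (- m)"] by (simp add: divide_pos_neg)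
  qed
  have "((\<lambda>t. t * m) \<longlongrightarrow> 0 * m) (at_right 0)"
    by (intro tendsto_intros)
  moreover have "\<forall>\<^sub>F t in at_right 0. b \<le> t * m"
    using eventually_at_right_less[of "0::real"] by eventually_elim (rule assms)
  ultimately show "b \<le> 0"
    using tendsto_lowerbound[of "\<lambda>t. t * m" "0 * m" "at_right 0" b] by simp
qed

section \<open>Desirable gambles and their separation from other gambles\<close>

lemma SDG_D:
  assumes "SDG K"
  shows SDG_subset: "K \<subseteq> hermitian_matrices"
    and SDG_add: "G \<in> K \<Longrightarrow> R \<in> K \<Longrightarrow> G + R \<in> K"
    and SDG_scaleR: "G \<in> K \<Longrightarrow> \<nu> > 0 \<Longrightarrow> \<nu> *\<^sub>R G \<in> K"
    and SDG_pos_semidef: "pos_semidef G \<Longrightarrow> G \<noteq> 0 \<Longrightarrow> G \<in> K"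
  using assms by (simp_all add: SDG_def)

lemma SDG_mat_1:
  fixes K :: "'n::finite cmat set"
  assumes "SDG K"
  shows "mat 1 \<in> K"
proof -
  have "mat 1 \<noteq> (0 :: 'n cmat)"
    by (simp add: vec_eq_iff mat_def)
  then show ?thesis
    by (rule SDG_pos_semidef[OF assms pos_semidef_mat_1])
qed

lemma SDG_separation:
  assumes K: "SDG K" and G: "G \<in> hermitian_matrices" "G \<notin> K"
  obtains A where "A \<in> hermitian_matrices" "A \<noteq> 0" "\<And>X. X \<in> K \<Longrightarrow> inner X A \<ge> 0" "inner G A \<le> 0"
proof -
  \<comment> \<open>Separating \<open>G\<close> from \<open>K\<close> itself could produce a functional vanishing on all Hermitian
    matrices; thickening \<open>K\<close> by the anti-Hermitian matrices prevents this.\<close>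
  define L where "L = {X. X + dagger X \<in> K}"
  have KL: "X + S \<in> L" if "X \<in> K" "dagger S = - S" for X S
  proof -
    have "X + S + dagger (X + S) = 2 *\<^sub>R X"
      using that SDG_subset[OF K] by (auto simp: dagger_add hermitian_matrices_def scaleR_2)
    then show ?thesis
      using SDG_scaleR[OF K \<open>X \<in> K\<close>, of 2] by (simp add: L_def)
  qed
  have 0: "dagger 0 = - (0 :: 'a cmat)"
    by (simp add: dagger_def vec_eq_iff)
  have "convex L"
  proof (rule convexI)
    fix X Y and u v :: real
    assume *: "X \<in> L" "Y \<in> L" "0 \<le> u" "0 \<le> v" "u + v = 1"
    have eq: "u *\<^sub>R X + v *\<^sub>R Y + dagger (u *\<^sub>R X + v *\<^sub>R Y)
        = u *\<^sub>R (X + dagger X) + v *\<^sub>R (Y + dagger Y)"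
      by (simp add: dagger_add dagger_scaleR algebra_simps)
    \<comment> \<open>\<open>K\<close> is closed under positive factors only and omits 0, so zero
      weights are treated apart.\<close>
    consider "u = 0" | "v = 0" | "u > 0" "v > 0"
      using * by linarith
    then show "u *\<^sub>R X + v *\<^sub>R Y \<in> L"
    proof cases
      case 3
      then have "u *\<^sub>R (X + dagger X) + v *\<^sub>R (Y + dagger Y) \<in> K"
        using * SDG_add[OF K SDG_scaleR[OF K] SDG_scaleR[OF K]] by (simp add: L_def)
      then show ?thesis
        by (simp add: L_def eq)
    qed (use * in simp_all)
  qed
  moreover have "L \<noteq> {}"
    using KL[OF SDG_mat_1[OF K] 0] by blast
  moreover have "G \<notin> L"
  proof
    assume "G \<in> L"
    then have "2 *\<^sub>R G \<in> K"
      using G(1) by (simp add: L_def hermitian_matrices_def scaleR_2)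
    then show False
      using SDG_scaleR[OF K, of "2 *\<^sub>R G" "1 / 2"] G(2) by simp
  qed
  ultimately obtain A b where A: "A \<noteq> 0" "inner A G \<le> b" "\<And>X. X \<in> L \<Longrightarrow> inner A X \<ge> b"
    using separating_hyperplane_sets[of "{G}" L] by auto
  \<comment> \<open>\<open>L\<close> contains every positive multiple of a member of
    \<open>K\<close>, so \<open>b\<close> bounds the functional on whole rays.\<close>
  have ray: "b \<le> t * inner A X" if "X \<in> K" "t > 0" for X t
    using A(3)[OF KL[OF SDG_scaleR[OF K that] 0]] by simp
  have "inner A G \<le> 0"
    using ray_bounded_below(2)[OF ray[OF SDG_mat_1[OF K]]] A(2) by linarith
  \<comment> \<open>Twice the anti-Hermitian part of \<open>A\<close>; the aim is to show that it
    vanishes.\<close>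
  define S where "S = A - dagger A"
  have S: "dagger S = - S"
    by (simp add: S_def dagger_diff dagger_dagger)
  \<comment> \<open>The whole line through \<open>mat 1\<close> in direction \<open>S\<close> lies
    in \<open>L\<close>, so the functional cannot vary along it.\<close>
  have "b \<le> inner A (mat 1) + t * inner A S" for t
  proof -
    have "dagger (t *\<^sub>R S) = - (t *\<^sub>R S)"
      by (simp add: dagger_scaleR S)
    from A(3)[OF KL[OF SDG_mat_1[OF K] this]] show ?thesis
      by (simp add: inner_add_right)
  qed
  then have "inner A S = 0"
    by (rule affine_bounded_below_slope_zero)
  \<comment> \<open>\<open>dagger\<close> is self-adjoint for \<open>inner\<close>, hence
    \<open>inner S S = 2 * inner A S = 0\<close>.\<close>
  moreover have "inner (dagger A) S = - inner A S"
    by (simp add: inner_dagger S)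
  ultimately have "inner S S = 0"
    by (subst (1) S_def) (simp add: inner_diff_left)
  then have "A \<in> hermitian_matrices"
    by (simp add: S_def hermitian_matrices_def)
  moreover have "inner X A \<ge> 0" if "X \<in> K" for X
    using ray_bounded_below(1)[OF ray[OF that]] by (simp add: inner_commute)
  ultimately show thesis
    using that[of A] A(1) \<open>inner A G \<le> 0\<close> by (simp add: inner_commute)
qed

section \<open>Membership and previsions under a singleton credal set\<close>

text \<open>Strict positivity is what contradicts separation, which yields only
  \<open>inner G A \<le> 0\<close>; gambles with \<open>gdot G \<rho> = 0\<close> are left
  undecided.\<close>

lemma SDG_member_if_gdot_pos:
  assumes K: "SDG K" and \<rho>: "quantum_credal_set K = {\<rho>}"
    and G: "G \<in> hermitian_matrices" "gdot G \<rho> > 0"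
  shows "G \<in> K"
proof (rule ccontr)
  assume "G \<notin> K"
  then obtain A where A: "A \<in> hermitian_matrices" "A \<noteq> 0"
      "\<And>X. X \<in> K \<Longrightarrow> inner X A \<ge> 0" "inner G A \<le> 0"
    using SDG_separation[OF K G(1)] by metis
  have nonneg: "inner B A \<ge> 0" if "pos_semidef B" for B
    using A(3) SDG_pos_semidef[OF K that] by (cases "B = 0") auto
  define r where "r = Re (trace A)"
  have "r > 0"
    unfolding r_def using A(1,2) nonneg by (rule Re_trace_pos)
  \<comment> \<open>As \<open>A\<close> is Hermitian, its trace equals its real part
    \<open>r\<close>, so the rescaled trace is exactly 1.\<close>
  have "trace ((1 / r) *\<^sub>R A) = (1 / r) *\<^sub>R trace A"
    by (simp add: trace_def scaleR_right.sum)
  also have "\<dots> = 1"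
    using \<open>r > 0\<close> hermitian_trace_real[OF A(1)]
    by (simp add: r_def scaleR_conv_of_real complex_eq_iff)
  finally have "(1 / r) *\<^sub>R A \<in> density_matrices"
    using pos_semidef_scaleR[OF pos_semidef_if_inner_nonneg[OF A(1) nonneg], of "1 / r"] \<open>r > 0\<close>
    by (simp add: density_matrices_def)
  then have "(1 / r) *\<^sub>R A \<in> quantum_credal_set K"
    using A(3) \<open>r > 0\<close> by (simp add: quantum_credal_set_def gdot_eq_inner)
  then have "\<rho> = (1 / r) *\<^sub>R A"
    using \<rho> by simp
  then have "gdot G \<rho> \<le> 0"
    using A(4) \<open>r > 0\<close> by (simp add: gdot_eq_inner divide_nonpos_pos)
  with G(2) show False
    by simp
qed

text \<open>Since \<rho> has trace 1, shifting \<open>G\<close> by \<open>c\<close> shifts its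
  pairing by \<open>c\<close>. Membership is thus decided for every \<open>c\<close> except
  \<open>gdot G \<rho>\<close>, and this one value affects neither the supremum nor the
  infimum.\<close>

lemma previsions_eq_gdot:
  assumes K: "SDG K" and \<rho>: "quantum_credal_set K = {\<rho>}" and G: "G \<in> hermitian_matrices"
  shows "lower_prevision K G = gdot G \<rho>" "upper_prevision K G = gdot G \<rho>"
proof -
  have \<rho>': "trace \<rho> = 1" "\<And>X. X \<in> K \<Longrightarrow> gdot X \<rho> \<ge> 0"
    using \<rho> by (auto simp: quantum_credal_set_def density_matrices_def)
  have gdot_low: "gdot (G - c *\<^sub>R mat 1) \<rho> = gdot G \<rho> - c" for c
    by (simp add: gdot_eq_inner inner_diff_left inner_mat_1 \<rho>')
  have gdot_up: "gdot (c *\<^sub>R mat 1 - G) \<rho> = c - gdot G \<rho>" for c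
    by (simp add: gdot_eq_inner inner_diff_left inner_mat_1 \<rho>')
  have herm: "G - c *\<^sub>R mat 1 \<in> hermitian_matrices" "c *\<^sub>R mat 1 - G \<in> hermitian_matrices" for c
    using G by (simp_all add: hermitian_matrices_def dagger_diff dagger_scaleR dagger_mat_1)
  have low_mem: "G - c *\<^sub>R mat 1 \<in> K" if "c < gdot G \<rho>" for c
    using SDG_member_if_gdot_pos[OF K \<rho> herm(1)] that by (simp add: gdot_low)
  have up_mem: "c *\<^sub>R mat 1 - G \<in> K" if "c > gdot G \<rho>" for c
    using SDG_member_if_gdot_pos[OF K \<rho> herm(2)] that by (simp add: gdot_up)
  show "lower_prevision K G = gdot G \<rho>"
    unfolding lower_prevision_def
  proof (rule cSup_eq)
    show "c \<le> gdot G \<rho>" if "c \<in> {c. G - c *\<^sub>R mat 1 \<in> K}" for c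
      using that \<rho>'(2)[of "G - c *\<^sub>R mat 1"] by (simp add: gdot_low)
    show "gdot G \<rho> \<le> y" if "\<And>c. c \<in> {c. G - c *\<^sub>R mat 1 \<in> K} \<Longrightarrow> c \<le> y" for y
      \<comment> \<open>Every \<open>c\<close> below \<open>gdot G \<rho>\<close> belongs to the
        set, so by density an upper bound cannot be smaller than
        \<open>gdot G \<rho>\<close>.\<close>
      by (rule dense_le) (simp add: that low_mem)
  qed
  show "upper_prevision K G = gdot G \<rho>"
    unfolding upper_prevision_def
  proof (rule cInf_eq)
    show "gdot G \<rho> \<le> c" if "c \<in> {c. c *\<^sub>R mat 1 - G \<in> K}" for c
      using that \<rho>'(2)[of "c *\<^sub>R mat 1 - G"] by (simp add: gdot_up)
    show "y \<le> gdot G \<rho>" if "\<And>c. c \<in> {c. c *\<^sub>R mat 1 - G \<in> K} \<Longrightarrow> y \<le> c" for y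
      by (rule dense_ge) (simp add: that up_mem)
  qed
qed

section \<open>The trace formula for projectors\<close>

text \<open>Cyclicity of the trace and idempotence reduce the right side to the trace of
  \<open>Q ** \<rho>\<close>.\<close>

lemma gdot_projector_eq_trace:
  assumes "Q ** Q = Q" "dagger Q = Q" "\<rho> \<in> hermitian_matrices"
  shows "complex_of_real (gdot Q \<rho>) = trace (Q ** \<rho> ** Q)"
proof -
  have "trace (Q ** \<rho> ** Q) = trace (Q ** (Q ** \<rho>))"
    by (rule trace_mul_sym)
  also have "\<dots> = trace (Q ** \<rho>)"
    by (simp add: matrix_mul_assoc assms(1))
  finally have eq: "trace (Q ** \<rho> ** Q) = trace (Q ** \<rho>)" .
  \<comment> \<open>\<open>Q ** \<rho>\<close> itself may fail to be Hermitian, so the reality of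
    its trace is read off from the sandwiched product.\<close>
  have "Q ** \<rho> ** Q \<in> hermitian_matrices"
    using assms by (simp add: hermitian_matrices_def dagger_mult matrix_mul_assoc)
  from hermitian_trace_real[OF this] show ?thesis
    by (simp add: eq gdot_def assms(2))
qed

theorem mainTheorem8:
  fixes K :: "'n::finite cmat set"
    and \<rho> :: "'n cmat"
    and P :: "'n \<Rightarrow> 'n cmat"
    and i :: 'n
  assumes "SDG K"
    and "quantum_credal_set K = {\<rho>}"
    and "projection_measurement P"
  shows "lower_prevision K (P i) = upper_prevision K (P i) \<and>
         complex_of_real (lower_prevision K (P i)) = trace (P i ** \<rho> ** P i)"
proof -
  have P: "P i ** P i = P i" "dagger (P i) = P i"
    using assms(3) by (simp_all add: projection_measurement_def)
  have "\<rho> \<in> hermitian_matrices"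
    using assms(2) by (auto simp: quantum_credal_set_def density_matrices_def pos_semidef_def)
  then show ?thesis
    using previsions_eq_gdot[OF assms(1,2), of "P i"] gdot_projector_eq_trace[OF P] P(2)
    by (simp add: hermitian_matrices_def)
qed

end
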